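(* For all integers $m\geq 4$ we have $$\mathrm{disp}(\mathcal{H}_{2,m})=\frac{3}{2^m}\left(1-\frac{3}{2^m}\right).$$ Further we have $\mathrm{disp}(\mathcal{H}_{2,1})=\frac12$, $\mathrm{disp}(\mathcal{H}_{2,2})=\frac38$ and $\mathrm{disp}(\mathcal{H}_{2,3})=\frac14$.
   Context: Dispersion: let $\mathcal{B}:=\{[x_1,y_1)\times[x_2,y_2)\mid 0\le x_1\le y_1\le 1,\ 0\le x_2\le y_2\le 1\}$. For a finite point set $\mathcal{P}\subset[0,1]^2$, $\mathrm{disp}(\mathcal{P}):=\sup_{B\in\mathcal{B},\,B\cap\mathcal{P}=\emptyset}\lambda(B)$, where $\lambda(B)$ is the area of $B$. For $m\ge 1$ the dyadic Hammersley point set is $\mathcal{H}_{2,m}:=\left\{\left(\frac{n}{2^m},\varphi_2(n)\right): n=0,1,\dots,2^m-1\right\}$, where for $n=e_1+2e_2+\dots+2^{m-1}e_m$ with $e_i\in\{0,1\}$ we set $\varphi_2(n)=\frac{e_1}{2}+\frac{e_2}{2^2}+\dots+\frac{e_m}{2^m}$. *)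

theory Defs
  imports "HOL-Analysis.Analysis"
begin

definition boxes :: "(real \<times> real) set set" where
  "boxes = {{x1..<y1} \<times> {x2..<y2} | x1 y1 x2 y2.
     0 \<le> x1 \<and> x1 \<le> y1 \<and> y1 \<le> 1 \<and> 0 \<le> x2 \<and> x2 \<le> y2 \<and> y2 \<le> 1}"

(* Intended for finite point sets in the unit square. The supremum is that of the reals;
   its side conditions (nonempty, bounded above) hold by disp_nonempty and disp_bdd_above. *)
definition disp :: "(real \<times> real) set \<Rightarrow> real" where
  "disp P = (SUP B \<in> {B \<in> boxes. B \<inter> P = {}}. measure lborel B)"

(* The m-digit radical inverse: e_i = (n div 2^(i-1)) mod 2 is the i-th binary digit of n,
   counted from 1 at the least significant end; see radical_inverse2_digits. *)
definition radical_inverse2 :: "nat \<Rightarrow> nat \<Rightarrow> real" where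
  "radical_inverse2 m n = (\<Sum>i = 1..m. real (n div 2 ^ (i - 1) mod 2) / 2 ^ i)"

definition hammersley2 :: "nat \<Rightarrow> (real \<times> real) set" where
  "hammersley2 m = (\<lambda>n. (real n / 2 ^ m, radical_inverse2 m n)) ` {0..<2 ^ m}"

lemma binary_digit_of_sum:
  fixes d :: "nat \<Rightarrow> nat"
  assumes "\<And>j. j < m \<Longrightarrow> d j \<in> {0, 1}" and "k < m"
  shows "(\<Sum>j<m. 2 ^ j * d j) div 2 ^ k mod 2 = d k"
  using assms
proof (induction m arbitrary: d k)
  case 0
  then show ?case by simp
next
  case (Suc m)
  define s where "s = (\<Sum>j<m. 2 ^ j * d (Suc j))"
  have s: "(\<Sum>j<Suc m. 2 ^ j * d j) = d 0 + 2 * s"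
    unfolding s_def sum.lessThan_Suc_shift by (simp add: sum_distrib_left mult.assoc)
  have d0: "d 0 \<in> {0, 1}" using Suc.prems(1)[of 0] by simp
  show ?case
  proof (cases k)
    case 0
    then show ?thesis using d0 unfolding s by auto
  next
    case (Suc k')
    have "s div 2 ^ k' mod 2 = d (Suc k')"
      unfolding s_def using Suc Suc.prems Suc.IH[of "\<lambda>j. d (Suc j)" k'] by simp
    moreover have "(d 0 + 2 * s) div 2 ^ Suc k' = s div 2 ^ k'"
    proof -
      have "(d 0 + 2 * s) div 2 ^ Suc k' = (d 0 + 2 * s) div 2 div 2 ^ k'"
        by (simp add: div_mult2_eq)
      also have "(d 0 + 2 * s) div 2 = s" using d0 by auto
      finally show ?thesis .
    qed
    ultimately show ?thesis unfolding s using Suc by simp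
  qed
qed

lemma radical_inverse2_digits:
  fixes e :: "nat \<Rightarrow> nat"
  assumes e: "\<And>i. 1 \<le> i \<Longrightarrow> i \<le> m \<Longrightarrow> e i \<in> {0, 1}"
  shows "radical_inverse2 m (\<Sum>i = 1..m. 2 ^ (i - 1) * e i) = (\<Sum>i = 1..m. real (e i) / 2 ^ i)"
proof -
  have shift: "(\<Sum>i = 1..m. 2 ^ (i - 1) * e i) = (\<Sum>j<m. 2 ^ j * e (Suc j))"
    by (rule sum.reindex_bij_witness[of _ Suc "\<lambda>i. i - 1"]) auto
  have "(\<Sum>j<m. 2 ^ j * e (Suc j)) div 2 ^ (i - 1) mod 2 = e i" if "1 \<le> i" "i \<le> m" for i
    using binary_digit_of_sum[of m "\<lambda>j. e (Suc j)" "i - 1"] that e by simp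
  then show ?thesis
    unfolding radical_inverse2_def shift by (intro sum.cong) auto
qed

lemma measure_box:
  fixes x1 y1 x2 y2 :: real
  assumes "x1 \<le> y1" "x2 \<le> y2"
  shows "measure lborel ({x1..<y1} \<times> {x2..<y2}) = (y1 - x1) * (y2 - x2)"
proof -
  have "emeasure lborel ({x1..<y1} \<times> {x2..<y2}) = ennreal ((y1 - x1) * (y2 - x2))"
    using assms
    by (simp add: lborel_prod[symmetric] lborel.emeasure_pair_measure_Times ennreal_mult)
  then show ?thesis using assms by (simp add: measure_def)
qed

lemma disp_nonempty: "{B \<in> boxes. B \<inter> P = {}} \<noteq> {}"
proof -
  have "{0..<0} \<times> {0..<0} \<in> boxes" unfolding boxes_def by fastforce
  then show ?thesis by auto
qed

lemma disp_bdd_above: "bdd_above (measure lborel ` {B \<in> boxes. B \<inter> P = {}})"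
proof (rule bdd_aboveI2[where M = 1])
  fix B assume "B \<in> {B \<in> boxes. B \<inter> P = {}}"
  then obtain x1 y1 x2 y2 where "B = {x1..<y1} \<times> {x2..<y2}"
    "0 \<le> x1" "x1 \<le> y1" "y1 \<le> 1" "0 \<le> x2" "x2 \<le> y2" "y2 \<le> 1"
    unfolding boxes_def by blast
  then show "measure lborel B \<le> 1"
    by (simp add: measure_box mult_le_one)
qed

end

theory Submission
  imports Defs
begin

text \<open>
  Write \<open>N = 2 ^ m\<close>.  Scaled by \<open>N\<close>, the point set becomes the graph of the bit reversal on
  \<open>{0..<N}\<close>.  An empty box meets only the lattice columns in some \<open>{a..<b}\<close> and the lattice rows in
  some \<open>{c..<d}\<close>, and after scaling its sides are at most \<open>b - a + 1\<close> and \<open>d - c + 1\<close>: the next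
  column or row on either side is the first that can stop it.  The heart of the proof is the bound
  \<open>(b - a + 1) * (d - c + 1) \<le> max (2 * N) (3 * N - 9)\<close> for empty lattice boxes
  (\<open>lattice_empty_area\<close>), by induction on \<open>m\<close>.

  A box in the lower half of the square sees only the points over even columns, which are the points
  for \<open>m - 1\<close> stretched horizontally by 2; the upper half is the same with odd columns.  Both sides of
  the bound at most double, so such boxes are settled by the induction hypothesis.  Bit reversal is an
  involution, hence the point set is symmetric about the diagonal and the left and right halves
  follow.  There remain the boxes that cross both midlines.  The two points next to the centre
  on the diagonal force two of the four sides of such a box to be as close to the centre as they can
  be.  If these are opposite sides, the box consists of the two central columns (or
  rows), and their points \<open>(N/2 - 1, N - 2)\<close> and \<open>(N/2, 1)\<close> leave the area \<open>3 * (N - 3)\<close>, which is the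
  extremal configuration for \<open>m \<ge> 4\<close>.  If they are adjacent sides, the box extends into just one
  quadrant, where points near a hyperbola around the centre bound its area by \<open>2 * N\<close>.

  For \<open>m = 3\<close> the maximum is \<open>2 * N = 16\<close>, which is attained.  For \<open>m = 1, 2\<close> the bound is too
  large, as boxes touching the left or lower border lose one unit of length (nothing lies beyond
  the border), and the few possible boxes are examined directly.  The lower bounds come from explicit
  open boxes, which are exhausted by half-open ones.
\<close>

section \<open>Bit reversal\<close>

fun bitrev :: "nat \<Rightarrow> nat \<Rightarrow> nat" where
  "bitrev 0 n = 0"
| "bitrev (Suc m) n = (n mod 2) * 2 ^ m + bitrev m (n div 2)"

lemma bitrev_less: "bitrev m n < 2 ^ m"
proof (induction m arbitrary: n)
  case (Suc m)
  have "(n mod 2) * 2 ^ m \<le> 1 * (2 :: nat) ^ m" by (rule mult_right_mono) auto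
  then show ?case using Suc[of "n div 2"] unfolding bitrev.simps power_Suc by linarith
qed simp

text \<open>
  The recursion strips the lowest digit of the argument; here the highest one is stripped.  Comparing
  the two shows that bit reversal is an involution, and this form is also the recursion that the
  radical inverse satisfies.
\<close>

lemma bitrev_Suc_top: "bitrev (Suc m) n = 2 * bitrev m n + n div 2 ^ m mod 2"
proof (induction m arbitrary: n)
  case (Suc m)
  show ?case
    by (subst bitrev.simps(2), subst Suc) (simp add: div_mult2_eq)
qed simp

lemma bitrev_add_period: "bitrev m (e * 2 ^ m + n) = bitrev m n"
proof (induction m arbitrary: n)
  case (Suc m)
  have eq: "e * 2 ^ Suc m + n = 2 * (e * 2 ^ m) + n" by simp
  have "(e * 2 ^ Suc m + n) mod 2 = n mod 2" "(e * 2 ^ Suc m + n) div 2 = e * 2 ^ m + n div 2"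
    unfolding eq by simp_all
  then show ?case by (simp only: bitrev.simps Suc)
qed simp

lemma bitrev_bitrev: "n < 2 ^ m \<Longrightarrow> bitrev m (bitrev m n) = n"
proof (induction m arbitrary: n)
  case (Suc m)
  define y where "y = bitrev m (n div 2)"
  have y: "y < 2 ^ m" unfolding y_def by (rule bitrev_less)
  have "bitrev (Suc m) (bitrev (Suc m) n)
      = 2 * bitrev m ((n mod 2) * 2 ^ m + y) + ((n mod 2) * 2 ^ m + y) div 2 ^ m mod 2"
    unfolding y_def by (subst bitrev_Suc_top) simp
  also have "\<dots> = 2 * bitrev m y + n mod 2"
    using y by (simp add: bitrev_add_period)
  also have "bitrev m y = n div 2"
    unfolding y_def using Suc by simp
  finally show ?case by simp
qed simp

lemma bitrev_numeral [simp]: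
  "bitrev (numeral k) n = (n mod 2) * 2 ^ pred_numeral k + bitrev (pred_numeral k) (n div 2)"
  by (simp add: numeral_eq_Suc)

lemma bitrev_zero [simp]: "bitrev m 0 = 0"
  by (induction m) auto

lemma bitrev_low_ones: "i \<le> m \<Longrightarrow> bitrev m (2 ^ i - 1) = 2 ^ m - 2 ^ (m - i)"
proof (induction m arbitrary: i)
  case (Suc m)
  show ?case
  proof (cases i)
    case (Suc i')
    have "(2::nat) ^ i = 2 * (2 ^ i' - 1) + 2"
      using one_le_power[of "2::nat" i'] unfolding Suc power_Suc by linarith
    then have *: "(2 ^ i - 1) mod 2 = (1::nat)" "(2 ^ i - 1) div 2 = (2 ^ i' - 1 :: nat)"
      by presburger+
    have "bitrev (Suc m) (2 ^ i - 1) = 2 ^ m + bitrev m (2 ^ i' - 1)"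
      unfolding bitrev.simps * by simp
    moreover have "(2::nat) ^ (m - i') \<le> 2 ^ m" by simp
    ultimately show ?thesis using Suc.IH[of i'] Suc.prems Suc by (simp add: mult_2)
  qed simp
qed simp

lemma radical_inverse2_eq_bitrev: "radical_inverse2 m n = real (bitrev m n) / 2 ^ m"
proof (induction m)
  case (Suc m)
  have "radical_inverse2 (Suc m) n = radical_inverse2 m n + real (n div 2 ^ m mod 2) / 2 ^ Suc m"
    unfolding radical_inverse2_def by simp
  then show ?case unfolding Suc bitrev_Suc_top by (simp add: field_simps)
qed (simp add: radical_inverse2_def)

section \<open>Empty lattice boxes\<close>

definition lattice_empty :: "nat \<Rightarrow> nat \<Rightarrow> nat \<Rightarrow> nat \<Rightarrow> nat \<Rightarrow> bool" where
  "lattice_empty m a b c d \<longleftrightarrow> (\<forall>n\<in>{a..<b}. bitrev m n \<notin> {c..<d})"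

lemma lattice_emptyD: "lattice_empty m a b c d \<Longrightarrow> a \<le> n \<Longrightarrow> n < b \<Longrightarrow> bitrev m n < c \<or> d \<le> bitrev m n"
  unfolding lattice_empty_def by force

text \<open>Symmetry of the point set about the diagonal: bit reversal is its own inverse.\<close>

lemma lattice_empty_swap:
  assumes "lattice_empty m a b c d" "d \<le> 2 ^ m"
  shows "lattice_empty m c d a b"
  unfolding lattice_empty_def
proof
  fix n assume n: "n \<in> {c..<d}"
  then have "bitrev m (bitrev m n) = n" using assms(2) by (intro bitrev_bitrev) auto
  then show "bitrev m n \<notin> {a..<b}" using assms(1) n unfolding lattice_empty_def by force
qed

text \<open>
  Columns \<open>2 * n\<close> carry the points of the set for \<open>m\<close> unchanged, columns \<open>2 * n + 1\<close> carry them
  raised by \<open>2 ^ m\<close>.  The halved bounds below single out the even and the odd members of \<open>{a..<b}\<close>.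
\<close>

lemma lattice_empty_lower_half:
  assumes "lattice_empty (Suc m) a b c d"
  shows "lattice_empty m ((a + 1) div 2) ((b + 1) div 2) c d"
  unfolding lattice_empty_def
proof
  fix n assume "n \<in> {(a + 1) div 2..<(b + 1) div 2}"
  then have "2 * n \<in> {a..<b}" by auto
  then have "bitrev (Suc m) (2 * n) \<notin> {c..<d}" using assms unfolding lattice_empty_def by blast
  then show "bitrev m n \<notin> {c..<d}" by simp
qed

lemma lattice_empty_upper_half:
  assumes "lattice_empty (Suc m) a b c d" "2 ^ m \<le> c"
  shows "lattice_empty m (a div 2) (b div 2) (c - 2 ^ m) (d - 2 ^ m)"
  unfolding lattice_empty_def
proof
  fix n assume "n \<in> {a div 2..<b div 2}"
  then have "2 * n + 1 \<in> {a..<b}" by auto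
  then have "bitrev (Suc m) (2 * n + 1) \<notin> {c..<d}" using assms unfolding lattice_empty_def by blast
  then show "bitrev m n \<notin> {c - 2 ^ m..<d - 2 ^ m}" using assms(2) by auto
qed

text \<open>
  Among \<open>k\<close> consecutive columns at least \<open>(k - 1) / 2\<close> have any given parity, so the width \<open>k + 1\<close>
  at most doubles when one passes back from the smaller point set.
\<close>

lemma half_box_area:
  assumes IH: "\<And>a b c d. \<lbrakk>a \<le> b; b \<le> 2 ^ m; c \<le> d; d \<le> 2 ^ m; lattice_empty m a b c d\<rbrakk>
      \<Longrightarrow> (b - a + 1) * (d - c + 1) \<le> max (2 * 2 ^ m) (3 * 2 ^ m - 9)"
    and box: "a \<le> b" "b \<le> 2 ^ Suc m" "c \<le> d" "d \<le> 2 ^ Suc m" "lattice_empty (Suc m) a b c d"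
    and half: "d \<le> 2 ^ m \<or> 2 ^ m \<le> c"
  shows "(b - a + 1) * (d - c + 1) \<le> max (2 * 2 ^ Suc m) (3 * 2 ^ Suc m - 9)"
proof -
  have width: "b - a + 1 \<le> 2 * (b' - a' + 1)" if "b + 2 * a' \<le> 2 * b' + (a + 1)" for a' b'
    using that by arith
  have "\<exists>a' b'. b - a + 1 \<le> 2 * (b' - a' + 1) \<and>
      (b' - a' + 1) * (d - c + 1) \<le> max (2 * 2 ^ m) (3 * 2 ^ m - 9)"
    using half
  proof
    assume "d \<le> 2 ^ m"
    then have "((b + 1) div 2 - (a + 1) div 2 + 1) * (d - c + 1) \<le> max (2 * 2 ^ m) (3 * 2 ^ m - 9)"
      using box by (intro IH lattice_empty_lower_half) auto
    moreover have "b \<le> 2 * ((b + 1) div 2)" by presburger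
    then have "b - a + 1 \<le> 2 * ((b + 1) div 2 - (a + 1) div 2 + 1)"
      by (intro width add_mono times_div_less_eq_dividend)
    ultimately show ?thesis by blast
  next
    assume c: "2 ^ m \<le> c"
    then have "(b div 2 - a div 2 + 1) * ((d - 2 ^ m) - (c - 2 ^ m) + 1)
        \<le> max (2 * 2 ^ m) (3 * 2 ^ m - 9)"
      using box by (intro IH lattice_empty_upper_half) auto
    moreover have "b \<le> 2 * (b div 2) + 1" by presburger
    then have "b + 2 * (a div 2) \<le> 2 * (b div 2) + 1 + a"
      by (intro add_mono times_div_less_eq_dividend)
    then have "b - a + 1 \<le> 2 * (b div 2 - a div 2 + 1)"
      by (intro width) (simp only: ac_simps)
    ultimately show ?thesis using c box(3) by auto
  qed
  then obtain a' b' where w: "b - a + 1 \<le> 2 * (b' - a' + 1)"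
    and wh: "(b' - a' + 1) * (d - c + 1) \<le> max (2 * 2 ^ m) (3 * 2 ^ m - 9)" by blast
  have "(b - a + 1) * (d - c + 1) \<le> 2 * (b' - a' + 1) * (d - c + 1)"
    using w by (rule mult_right_mono) simp
  also have "\<dots> \<le> 2 * max (2 * 2 ^ m) (3 * 2 ^ m - 9)" using wh by simp
  also have "\<dots> \<le> max (2 * 2 ^ Suc m) (3 * 2 ^ Suc m - 9)" by simp
  finally show ?thesis .
qed

text \<open>
  A rectangle that, for each \<open>i\<close>, stops horizontally at \<open>2 ^ (i + 1)\<close> or vertically at
  \<open>2 ^ (k + 1 - i)\<close> lies below a staircase with corners on the hyperbola \<open>x * y = 2 ^ (k + 3)\<close>:
  the first \<open>i\<close> at which it stops horizontally and the step before it, at which it must have stopped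
  vertically, give \<open>w \<le> 2 ^ (i + 1)\<close> and \<open>h \<le> 2 ^ (k + 2 - i)\<close>.  The induction on \<open>i\<close> searches for this
  step; if there is none, the rectangle has height at most 2.
\<close>

lemma hyperbola_area:
  fixes w h k :: nat
  assumes front: "\<And>i. i \<le> k \<Longrightarrow> w \<le> 2 ^ (i + 1) \<or> h \<le> 2 ^ (k + 1 - i)"
    and w: "2 < w" "w \<le> 2 ^ (k + 1) + 2"
  shows "w * h \<le> 2 ^ (k + 3)"
proof -
  have "w * h \<le> 2 ^ (k + 3) \<or> h \<le> 2 ^ (k + 1 - i)" if "i \<le> k" for i
    using that
  proof (induction i)
    case 0
    then show ?case using front[of 0] w(1) by auto
  next
    case (Suc i)
    have "w * h \<le> 2 ^ (k + 3)" if "w \<le> 2 ^ (Suc i + 1)" "h \<le> 2 ^ (k + 1 - i)"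
    proof -
      have "w * h \<le> 2 ^ (Suc i + 1) * 2 ^ (k + 1 - i)" using that by (rule mult_mono) auto
      also have "\<dots> = 2 ^ (k + 3)" using Suc.prems by (simp flip: power_add power_Suc add: numeral_3_eq_3)
      finally show ?thesis .
    qed
    then show ?case using Suc front[of "Suc i"] by fastforce
  qed
  from this[of k] show ?thesis
  proof
    assume "h \<le> 2 ^ (k + 1 - k)"
    then have "w * h \<le> (2 ^ (k + 1) + 2) * 2" using w(2) by (intro mult_mono) auto
    also have "\<dots> \<le> 4 * 2 ^ (k + 1)" by simp
    also have "\<dots> = 2 ^ (k + 3)" by (simp add: power_add)
    finally show ?thesis .
  qed simp
qed

section \<open>Boxes that cross both midlines\<close>

text \<open>
  Now there are \<open>k + 2\<close> digits, and \<open>M\<close> is half the side length, so that \<open>(M, M)\<close> is the centre.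
\<close>

context
  fixes k M :: nat
  defines "M \<equiv> 2 ^ Suc k"
begin

lemma bitrev_below_centre: "bitrev (Suc (Suc k)) (M - 2) = M - 2"
proof -
  have M: "M - 2 = 2 * (2 ^ k - 1)" unfolding M_def by (simp add: algebra_simps)
  have "bitrev (Suc (Suc k)) (2 * (2 ^ k - 1)) = bitrev (Suc k) (2 ^ k - 1)" by simp
  also have "\<dots> = 2 * (2 ^ k - 1)"
    unfolding bitrev_Suc_top using bitrev_low_ones[of k k] by simp
  finally show ?thesis unfolding M .
qed

lemma bitrev_left_of_centre: "bitrev (Suc (Suc k)) (M - 1) = 2 * M - 2"
proof -
  have M: "M - 1 = 2 * (2 ^ k - 1) + 1" using one_le_power[of "2::nat" k]
    unfolding M_def power_Suc by linarith
  have "bitrev (Suc (Suc k)) (2 * (2 ^ k - 1) + 1) = M + bitrev (Suc k) (2 ^ k - 1)"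
    unfolding M_def by simp
  also have "\<dots> = M + 2 * (2 ^ k - 1)"
    unfolding bitrev_Suc_top using bitrev_low_ones[of k k] by simp
  also have "\<dots> = 2 * M - 2"
    using one_le_power[of "2::nat" k] unfolding M_def power_Suc by linarith
  finally show ?thesis unfolding M .
qed

lemma bitrev_above_centre: "bitrev (Suc (Suc k)) (M + 1) = M + 1"
proof -
  have "bitrev (Suc (Suc k)) (2 * 2 ^ k + 1) = M + bitrev (Suc k) (2 ^ k)" unfolding M_def by simp
  also have "bitrev (Suc k) (2 ^ k) = 1"
    unfolding bitrev_Suc_top using bitrev_add_period[of k 1 0] by simp
  finally show ?thesis unfolding M_def by simp
qed

text \<open>
  In binary the column \<open>M + 2 ^ (i + 1) - 2\<close> is a leading one, zeros, a block of \<open>i\<close> ones, and a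
  final zero; in the reversal the block follows the leading digit, now zero.  The points obtained in
  this way are at horizontal distance about \<open>2 ^ (i + 1)\<close> and vertical distance about
  \<open>2 ^ (k + 1 - i)\<close> from the centre, in the lower right quadrant.
\<close>

lemma bitrev_front:
  assumes "i \<le> k"
  shows "bitrev (Suc (Suc k)) (M + 2 ^ (i + 1) - 2) = M + 1 - 2 ^ (k + 1 - i)"
proof -
  have le: "(2::nat) ^ i \<le> 2 ^ k" using assms by simp
  have le': "(2::nat) ^ (k - i) \<le> 2 ^ k" by simp
  have pos: "(1::nat) \<le> 2 ^ i" by simp
  have M: "M + 2 ^ (i + 1) - 2 = 2 * (1 * 2 ^ k + (2 ^ i - 1))"
    unfolding M_def using pos by (simp add: algebra_simps)
  have lt: "(2::nat) ^ i - 1 < 2 ^ k" using le pos by linarith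
  have top: "(1 * 2 ^ k + (2 ^ i - 1)) div 2 ^ k = (1::nat)"
    by (subst div_mult_self3) (use lt in simp_all)
  have "bitrev (Suc (Suc k)) (M + 2 ^ (i + 1) - 2) = bitrev (Suc k) (1 * 2 ^ k + (2 ^ i - 1))"
    unfolding M by simp
  also have "\<dots> = 2 * bitrev k (2 ^ i - 1) + 1"
    unfolding bitrev_Suc_top bitrev_add_period top by simp
  also have "\<dots> = 2 * (2 ^ k - 2 ^ (k - i)) + 1" using bitrev_low_ones[OF assms] by simp
  also have "\<dots> = M + 1 - 2 ^ (k + 1 - i)"
    unfolding M_def using le' assms by (simp add: Suc_diff_le algebra_simps)
  finally show ?thesis .
qed

text \<open>
  The two central columns: the left one has its point in the row \<open>2 * M - 2\<close>, the right one in the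
  row \<open>1\<close>.
\<close>

lemma central_box_area_thin:
  assumes "lattice_empty (Suc (Suc k)) (M - 1) (M + 1) c d" "c < M" "M < d" "d \<le> 2 * M"
  shows "((M + 1) - (M - 1) + 1) * (d - c + 1) \<le> 3 * (2 * M) - 9"
proof -
  have M2: "2 \<le> M" unfolding M_def by simp
  have "d \<le> 2 * M - 2"
    using lattice_emptyD[OF assms(1), of "M - 1"] bitrev_left_of_centre M2 assms(2-4) by linarith
  moreover have "bitrev (Suc (Suc k)) M = 1"
    using bitrev_front[of 0] by (simp add: M_def)
  then have "2 \<le> c"
    using lattice_emptyD[OF assms(1), of M] M2 assms(2-4) by linarith
  ultimately show ?thesis using M2 assms by simp
qed

text \<open>
  A box reaching one column to the left of the centre line and up to row \<open>M\<close> extends to the lower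
  right, where the points of \<open>bitrev_front\<close> supply the staircase for \<open>hyperbola_area\<close>.
\<close>

lemma central_box_area_corner:
  assumes emp: "lattice_empty (Suc (Suc k)) (M - 1) b c (M + 1)"
    and "M < b" "b \<le> 2 * M" "c < M"
  shows "(b - (M - 1) + 1) * (M + 1 - c + 1) \<le> 4 * M"
proof -
  have M2: "2 \<le> M" unfolding M_def by simp
  have "(b - (M - 1) + 1) * (M + 1 - c + 1) \<le> 2 ^ (k + 3)"
  proof (rule hyperbola_area)
    fix i assume i: "i \<le> k"
    \<comment> \<open>Facts that keep the truncated subtractions below exact.\<close>
    have p: "(2::nat) \<le> 2 ^ (i + 1)" "(2::nat) ^ (k + 1 - i) \<le> M" "(2::nat) \<le> 2 ^ (k + 1 - i)"
      using i by (auto simp: M_def Suc_diff_le)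
    show "b - (M - 1) + 1 \<le> 2 ^ (i + 1) \<or> M + 1 - c + 1 \<le> 2 ^ (k + 1 - i)"
    proof (cases "M + 2 ^ (i + 1) - 2 < b")
      case True
      then have "M + 1 - 2 ^ (k + 1 - i) < c"
        using lattice_emptyD[OF emp, of "M + 2 ^ (i + 1) - 2"] bitrev_front[OF i] p by linarith
      then show ?thesis using p by linarith
    qed (use p M2 in linarith)
  qed (use assms M2 M_def in auto)
  also have "(2::nat) ^ (k + 3) = 4 * M" unfolding M_def by (simp add: power_add)
  finally show ?thesis .
qed

text \<open>
  The points \<open>(M - 2, M - 2)\<close> and \<open>(M + 1, M + 1)\<close> pin two sides of the box to the centre.
  The four combinations are two pairs related by the symmetry about the diagonal.
\<close>

lemma central_box_area:
  assumes emp: "lattice_empty (Suc (Suc k)) a b c d"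
    and box: "a < M" "M < b" "b \<le> 2 * M" "c < M" "M < d" "d \<le> 2 * M"
  shows "(b - a + 1) * (d - c + 1) \<le> max (2 * (2 * M)) (3 * (2 * M) - 9)"
proof -
  have M2: "2 \<le> M" unfolding M_def by simp
  have swap: "lattice_empty (Suc (Suc k)) c d a b"
    using lattice_empty_swap[OF emp] box by (simp add: M_def)
  have 1: "a = M - 1 \<or> c = M - 1"
    using lattice_emptyD[OF emp, of "M - 2"] bitrev_below_centre box M2 by linarith
  have 2: "b = M + 1 \<or> d = M + 1"
    using lattice_emptyD[OF emp, of "M + 1"] bitrev_above_centre box M2 by linarith
  from 1 2 consider "a = M - 1" "b = M + 1" | "c = M - 1" "d = M + 1"
    | "a = M - 1" "d = M + 1" | "c = M - 1" "b = M + 1" by blast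
  then show ?thesis
  proof cases
    case 1
    then show ?thesis using central_box_area_thin[of c d] emp box by (simp only: le_max_iff_disj) blast
  next
    case 2
    then show ?thesis using central_box_area_thin[of a b] swap box
      by (simp only: le_max_iff_disj mult.commute[of "b - a + 1"]) blast
  next
    case 3
    then show ?thesis using central_box_area_corner[of b c] emp box by simp
  next
    case 4
    then have "(d - c + 1) * (b - a + 1) \<le> 4 * M"
      using central_box_area_corner[of d a] swap box by blast
    then show ?thesis by (simp only: mult.commute[of "b - a + 1"] le_max_iff_disj) simp
  qed
qed

end

section \<open>The area of an empty lattice box\<close>

text \<open>
  The maximum with \<open>2 * 2 ^ m\<close>, which dominates just for \<open>m \<le> 3\<close>, lets the induction start at
  \<open>m = 0\<close> and still gives the sharp value from \<open>m = 3\<close> on.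
\<close>

lemma lattice_empty_area:
  assumes "a \<le> b" "b \<le> 2 ^ m" "c \<le> d" "d \<le> 2 ^ m" "lattice_empty m a b c d"
  shows "(b - a + 1) * (d - c + 1) \<le> max (2 * 2 ^ m) (3 * 2 ^ m - 9)"
  using assms
proof (induction m arbitrary: a b c d)
  case 0
  have "b - a = 0 \<or> d - c = 0"
    using lattice_emptyD[OF 0(5), of 0] 0 by (cases "a = 0"; cases "b = 0"; auto)
  then show ?case using 0 by auto
next
  case (Suc m)
  have swap: "lattice_empty (Suc m) c d a b" using lattice_empty_swap Suc.prems by blast
  consider "d \<le> 2 ^ m \<or> 2 ^ m \<le> c" | "b \<le> 2 ^ m \<or> 2 ^ m \<le> a"
    | "a < 2 ^ m" "2 ^ m < b" "c < 2 ^ m" "2 ^ m < d" by linarith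
  then show ?case
  proof cases
    case 1
    show ?thesis by (rule half_box_area[OF Suc.IH Suc.prems 1])
  next
    case 2
    have "(d - c + 1) * (b - a + 1) \<le> max (2 * 2 ^ Suc m) (3 * 2 ^ Suc m - 9)"
      using half_box_area[OF Suc.IH _ _ _ _ swap 2] Suc.prems by blast
    then show ?thesis by (simp only: mult.commute)
  next
    case 3
    show ?thesis
    proof (cases m)
      case 0
      then show ?thesis using lattice_emptyD[OF Suc.prems(5), of 0] 3 by simp
    next
      case (Suc k)
      then show ?thesis using central_box_area[of k a b c d] Suc.prems 3 by simp
    qed
  qed
qed

section \<open>From lattice boxes to the dispersion\<close>

lemma hammersley2_eq:
  "hammersley2 m = (\<lambda>n. (real n / 2 ^ m, real (bitrev m n) / 2 ^ m)) ` {0..<2 ^ m}"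
  unfolding hammersley2_def radical_inverse2_eq_bitrev ..

text \<open>
  The lattice points of \<open>[N * x, N * y)\<close> are those of \<open>{a..<b}\<close>, and its length is at most
  \<open>b - (a - 1)\<close>.  The truncated subtraction \<open>a - 1\<close> is intended: at \<open>a = 0\<close> the interval cannot
  extend to the left of \<open>0\<close>, and the length is at most \<open>b\<close>.  This loss at the border decides the
  cases \<open>m = 1\<close> and \<open>m = 2\<close>.
\<close>

lemma grid_interval:
  fixes x y N :: real
  assumes "0 \<le> x" "x \<le> y" "0 < N"
  defines "a \<equiv> nat \<lceil>N * x\<rceil>" and "b \<equiv> nat \<lceil>N * y\<rceil>"
  shows "a \<le> b" "N * (y - x) \<le> real (b - (a - 1))"
    "n \<in> {a..<b} \<longleftrightarrow> real n / N \<in> {x..<y}"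
proof -
  have le: "N * x \<le> N * y" using assms by simp
  have nn: "0 \<le> N * x" using assms by simp
  show ab: "a \<le> b" unfolding a_def b_def using le by (intro nat_mono ceiling_mono)
  have a: "real a = of_int \<lceil>N * x\<rceil>" and b: "real b = of_int \<lceil>N * y\<rceil>"
    unfolding a_def b_def using nn le by (simp_all add: of_nat_nat)
  have "real (a - 1) \<le> N * x"
  proof (cases "a = 0")
    case False
    then show ?thesis using a by (simp add: of_nat_diff)
  qed (use nn in simp)
  moreover have "N * y \<le> real b" unfolding b by simp
  ultimately show "N * (y - x) \<le> real (b - (a - 1))"
    using ab by (simp add: of_nat_diff algebra_simps)
  have "a \<le> n \<longleftrightarrow> N * x \<le> real n"
    unfolding a_def by (simp add: nat_le_iff ceiling_le_iff)
  moreover have "n < b \<longleftrightarrow> real n < N * y"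
    unfolding b_def by (simp add: zless_nat_eq_int_zless less_ceiling_iff)
  ultimately show "n \<in> {a..<b} \<longleftrightarrow> real n / N \<in> {x..<y}"
    using assms by (simp add: field_simps)
qed

lemma disp_hammersley2_le:
  assumes "\<And>a b c d. \<lbrakk>a \<le> b; b \<le> 2 ^ m; c \<le> d; d \<le> 2 ^ m; lattice_empty m a b c d\<rbrakk>
      \<Longrightarrow> (b - (a - 1)) * (d - (c - 1)) \<le> K"
  shows "disp (hammersley2 m) \<le> real K / (2 ^ m) ^ 2"
  unfolding disp_def
proof (rule cSUP_least[OF disp_nonempty])
  fix B assume "B \<in> {B \<in> boxes. B \<inter> hammersley2 m = {}}"
  then obtain x1 y1 x2 y2 where B: "B = {x1..<y1} \<times> {x2..<y2}"
    and b1: "0 \<le> x1" "x1 \<le> y1" "y1 \<le> 1" and b2: "0 \<le> x2" "x2 \<le> y2" "y2 \<le> 1"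
    and emp: "B \<inter> hammersley2 m = {}"
    unfolding boxes_def by blast
  define N :: real where "N = 2 ^ m"
  have N: "0 < N" unfolding N_def by simp
  define a b c d where "a = nat \<lceil>N * x1\<rceil>" "b = nat \<lceil>N * y1\<rceil>" "c = nat \<lceil>N * x2\<rceil>" "d = nat \<lceil>N * y2\<rceil>"
  note g1 = grid_interval[OF b1(1,2) N, folded a_b_c_d_def]
  note g2 = grid_interval[OF b2(1,2) N, folded a_b_c_d_def]
  have "b \<le> 2 ^ m" "d \<le> 2 ^ m"
    unfolding a_b_c_d_def using b1(3) b2(3) N
    by (auto simp: nat_le_iff ceiling_le_iff N_def)
  moreover have "lattice_empty m a b c d"
    unfolding lattice_empty_def
  proof
    fix n assume n: "n \<in> {a..<b}"
    then have "n < 2 ^ m" using \<open>b \<le> 2 ^ m\<close> by simp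
    then have "(real n / N, real (bitrev m n) / N) \<in> hammersley2 m"
      unfolding hammersley2_eq N_def by simp
    then have "(real n / N, real (bitrev m n) / N) \<notin> B" using emp by blast
    then show "bitrev m n \<notin> {c..<d}" using n g1(3) g2(3) unfolding B by blast
  qed
  ultimately have K: "(b - (a - 1)) * (d - (c - 1)) \<le> K" using assms g1(1) g2(1) by blast
  have "(N * (y1 - x1)) * (N * (y2 - x2)) \<le> real (b - (a - 1)) * real (d - (c - 1))"
    using g1(2) g2(2) b1 b2 N by (intro mult_mono) auto
  also have "\<dots> \<le> real K" using K by (simp only: flip: of_nat_mult)
  finally have "(y1 - x1) * (y2 - x2) \<le> real K / N ^ 2"
    using N by (simp add: field_simps power2_eq_square)
  then show "measure lborel B \<le> real K / (2 ^ m) ^ 2"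
    unfolding B measure_box[OF b1(2) b2(2)] N_def .
qed

text \<open>
  Half-open boxes must give up the left and lower edges of the open box, so its area is a supremum:
  shrinking both sides by the factor \<open>sqrt z\<close> gives area \<open>z\<close> times the original, for every \<open>z < 1\<close>.
\<close>

lemma disp_ge_open_box:
  assumes x: "0 \<le> x1" "x1 < y1" "y1 \<le> 1" and y: "0 \<le> x2" "x2 < y2" "y2 \<le> 1"
    and emp: "({x1<..<y1} \<times> {x2<..<y2}) \<inter> P = {}"
  shows "(y1 - x1) * (y2 - x2) \<le> disp P"
proof (rule field_le_mult_one_interval)
  fix z :: real assume z: "0 < z" "z < 1"
  define s where "s = sqrt z"
  have s: "0 < s" "s < 1" "s * s = z" unfolding s_def using z by auto
  define u v where "u = y1 - s * (y1 - x1)" "v = y2 - s * (y2 - x2)"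
  have "s * (y1 - x1) < y1 - x1" "s * (y2 - x2) < y2 - x2" using s x y by auto
  then have uv: "x1 < u" "x2 < v" unfolding u_v_def by simp_all
  have uv': "u < y1" "v < y2" unfolding u_v_def using s x y by simp_all
  have "{u..<y1} \<times> {v..<y2} \<in> boxes" unfolding boxes_def using uv uv' x y by force
  moreover have "{u..<y1} \<times> {v..<y2} \<inter> P = {}"
  proof -
    have "{u..<y1} \<times> {v..<y2} \<subseteq> {x1<..<y1} \<times> {x2<..<y2}" using uv by auto
    then show ?thesis using emp by blast
  qed
  ultimately have "measure lborel ({u..<y1} \<times> {v..<y2}) \<le> disp P"
    unfolding disp_def by (intro cSUP_upper disp_bdd_above) auto
  moreover have "measure lborel ({u..<y1} \<times> {v..<y2}) = z * ((y1 - x1) * (y2 - x2))"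
    using uv' by (simp add: measure_box u_v_def flip: s(3))
  ultimately show "z * ((y1 - x1) * (y2 - x2)) \<le> disp P" by simp
qed

lemma disp_hammersley2_ge:
  assumes "a < b" "b \<le> 2 ^ m" "c < d" "d \<le> 2 ^ m"
    and emp: "lattice_empty m (Suc a) b (Suc c) d"
  shows "real ((b - a) * (d - c)) / (2 ^ m) ^ 2 \<le> disp (hammersley2 m)"
proof -
  define N :: real where "N = 2 ^ m"
  have N: "0 < N" "real b \<le> N" "real d \<le> N"
    unfolding N_def using assms(2,4) by simp_all
  have "(real b / N - real a / N) * (real d / N - real c / N) \<le> disp (hammersley2 m)"
  proof (rule disp_ge_open_box)
    show "({real a / N<..<real b / N} \<times> {real c / N<..<real d / N}) \<inter> hammersley2 m = {}"
    proof -
      have False if "real a / N < real n / N" "real n / N < real b / N"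
        "real c / N < real (bitrev m n) / N" "real (bitrev m n) / N < real d / N" for n
        using that N lattice_emptyD[OF emp, of n] by (simp add: divide_less_cancel)
      then show ?thesis unfolding hammersley2_eq N_def[symmetric] by fastforce
    qed
  qed (use N assms(1-4) in \<open>auto simp: divide_strict_right_mono\<close>)
  then show ?thesis
    using assms N unfolding N_def[symmetric]
    by (simp add: of_nat_diff field_simps power2_eq_square)
qed

lemma disp_hammersley2_le_general:
  "disp (hammersley2 m) \<le> real (max (2 * 2 ^ m) (3 * 2 ^ m - 9)) / (2 ^ m) ^ 2"
proof (rule disp_hammersley2_le)
  fix a b c d :: nat
  assume *: "a \<le> b" "b \<le> 2 ^ m" "c \<le> d" "d \<le> 2 ^ m" "lattice_empty m a b c d"
  have "(b - (a - 1)) * (d - (c - 1)) \<le> (b - a + 1) * (d - c + 1)"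
    using * by (intro mult_mono) auto
  also have "\<dots> \<le> max (2 * 2 ^ m) (3 * 2 ^ m - 9)" by (rule lattice_empty_area[OF *])
  finally show "(b - (a - 1)) * (d - (c - 1)) \<le> max (2 * 2 ^ m) (3 * 2 ^ m - 9)" .
qed

section \<open>The values of the dispersion\<close>

text \<open>
  The extremal box is bounded by the columns \<open>M - 2\<close> and \<open>M + 1\<close> and the rows \<open>1\<close> and \<open>2 * M - 2\<close>,
  where \<open>M\<close> is half of \<open>2 ^ m\<close>.
\<close>

lemma disp_hammersley2_large:
  assumes "4 \<le> m"
  shows "disp (hammersley2 m) = 3 / 2 ^ m * (1 - 3 / 2 ^ m)"
proof -
  obtain k where k: "m = Suc (Suc k)" using assms that[of "m - 2"] by simp
  define M :: nat where "M = 2 ^ Suc k"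
  have pow: "2 ^ m = 2 * M" unfolding M_def k by simp
  have "(2::nat) ^ 4 \<le> 2 ^ m" using assms by (intro power_increasing) auto
  then have M: "8 \<le> M" unfolding pow by simp
  have powr: "(2::real) ^ m = 2 * real M" unfolding M_def k by simp
  have area: "real (3 * (2 * M - 3)) / (2 ^ m) ^ 2 = 3 / 2 ^ m * (1 - 3 / 2 ^ m)"
    unfolding powr using M by (simp add: of_nat_diff field_simps power2_eq_square)
  have "max (2 * 2 ^ m) (3 * 2 ^ m - 9) = 3 * (2 * M - 3)" unfolding pow using M by simp
  then have upper: "disp (hammersley2 m) \<le> 3 / 2 ^ m * (1 - 3 / 2 ^ m)"
    using disp_hammersley2_le_general[of m] area by simp
  have left: "bitrev m (M - 1) = 2 * M - 2"
    unfolding k M_def by (rule bitrev_left_of_centre)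
  have right: "bitrev m M = 1"
    using bitrev_front[of 0 k] unfolding k M_def by simp
  have "lattice_empty m (Suc (M - 2)) (M + 1) (Suc 1) (2 * M - 2)"
    unfolding lattice_empty_def
  proof
    fix n assume "n \<in> {Suc (M - 2)..<M + 1}"
    then have "n = M - 1 \<or> n = M" by auto
    then show "bitrev m n \<notin> {Suc 1..<2 * M - 2}" using left right by auto
  qed
  then have "real ((M + 1 - (M - 2)) * (2 * M - 2 - 1)) / (2 ^ m) ^ 2 \<le> disp (hammersley2 m)"
    using M by (intro disp_hammersley2_ge) (auto simp: pow)
  moreover have "(M + 1 - (M - 2)) * (2 * M - 2 - 1) = 3 * (2 * M - 3)" using M by simp
  ultimately show ?thesis using upper area by (simp only: order.antisym)
qed

lemma disp_hammersley2_three: "disp (hammersley2 3) = 1 / 4"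
proof (rule antisym)
  show "disp (hammersley2 3) \<le> 1 / 4" using disp_hammersley2_le_general[of 3] by simp
  have "lattice_empty 3 (Suc 1) 5 (Suc 2) 6" unfolding lattice_empty_def
  proof
    fix n :: nat assume "n \<in> {Suc 1..<5}"
    then have "n = 2 \<or> n = 3 \<or> n = 4" by auto
    then show "bitrev 3 n \<notin> {Suc 2..<6}" by auto
  qed
  then have "real ((5 - 1) * (6 - 2)) / (2 ^ 3) ^ 2 \<le> disp (hammersley2 3)"
    by (intro disp_hammersley2_ge) auto
  then show "1 / 4 \<le> disp (hammersley2 3)" by simp
qed

text \<open>
  For \<open>m = 2\<close> the sides of an empty box are at most 4.  A side longer than 1 forces the box to
  contain one of the columns \<open>1, 2, 3\<close>, a side longer than 2 two adjacent ones, and a side longer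
  than 3 all of them; likewise for rows.  The points \<open>(1, 2)\<close>, \<open>(2, 1)\<close>, \<open>(3, 3)\<close> then
  exclude every product larger than 6.
\<close>

lemma disp_hammersley2_two: "disp (hammersley2 2) = 3 / 8"
proof (rule antisym)
  have "(b - (a - 1)) * (d - (c - 1)) \<le> 6"
    if box: "a \<le> b" "b \<le> 2 ^ 2" "c \<le> d" "d \<le> 2 ^ 2" and emp: "lattice_empty 2 a b c d"
    for a b c d
  proof -
    define w h where "w = b - (a - 1)" "h = d - (c - 1)"
    have "bitrev 2 1 = 2" "bitrev 2 2 = 1" "bitrev 2 3 = 3" by simp_all
    then have pts: "1 \<notin> {a..<b} \<or> 2 \<notin> {c..<d}" "2 \<notin> {a..<b} \<or> 1 \<notin> {c..<d}"
      "3 \<notin> {a..<b} \<or> 3 \<notin> {c..<d}"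
      using emp unfolding lattice_empty_def by metis+
    have le: "b \<le> 4" "d \<le> 4" using box by simp_all
    then have le4: "w \<le> 4" "h \<le> 4" using box unfolding w_h_def by auto
    have span: "q - (p - 1) \<le> 1 \<or> 1 \<in> {p..<q} \<or> 2 \<in> {p..<q} \<or> 3 \<in> {p..<q}"
        "q - (p - 1) \<le> 2 \<or> 2 \<in> {p..<q} \<and> (1 \<in> {p..<q} \<or> 3 \<in> {p..<q})"
        "q - (p - 1) \<le> 3 \<or> 1 \<in> {p..<q} \<and> 2 \<in> {p..<q} \<and> 3 \<in> {p..<q}"
      if "p \<le> q" "q \<le> 4" for p q :: nat
      using that unfolding atLeastLessThan_iff by arith+
    note spans = span[OF box(1) le(1), folded w_h_def] span[OF box(3) le(2), folded w_h_def]
    have "w \<le> 1 \<or> h \<le> 3" using spans pts by blast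
    moreover have "h \<le> 1 \<or> w \<le> 3" using spans pts by blast
    moreover have "w \<le> 2 \<or> h \<le> 2" using spans pts by blast
    ultimately consider "w \<le> 1" | "h \<le> 1" | "w \<le> 2" "h \<le> 3" | "w \<le> 3" "h \<le> 2" by linarith
    then have "w * h \<le> 6"
    proof cases
      case 1
      then show ?thesis using mult_mono[of w 1 h 4] le4 by simp
    next
      case 2
      then show ?thesis using mult_mono[of w 4 h 1] le4 by simp
    next
      case 3
      then show ?thesis using mult_mono[of w 2 h 3] by simp
    next
      case 4
      then show ?thesis using mult_mono[of w 3 h 2] by simp
    qed
    then show ?thesis unfolding w_h_def .
  qed
  then have "disp (hammersley2 2) \<le> real 6 / (2 ^ 2) ^ 2"
    by (rule disp_hammersley2_le)
  then show "disp (hammersley2 2) \<le> 3 / 8" by simp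
  have "lattice_empty 2 (Suc 1) 4 (Suc 1) 3" unfolding lattice_empty_def
  proof
    fix n :: nat assume "n \<in> {Suc 1..<4}"
    then have "n = 2 \<or> n = 3" by auto
    then show "bitrev 2 n \<notin> {Suc 1..<3}" by auto
  qed
  then have "real ((4 - 1) * (3 - 1)) / (2 ^ 2) ^ 2 \<le> disp (hammersley2 2)"
    by (intro disp_hammersley2_ge) auto
  then show "3 / 8 \<le> disp (hammersley2 2)" by simp
qed

text \<open>For \<open>m = 1\<close> the point \<open>(1, 1)\<close> keeps a box from having both sides longer than 1.\<close>

lemma disp_hammersley2_one: "disp (hammersley2 1) = 1 / 2"
proof (rule antisym)
  have "(b - (a - 1)) * (d - (c - 1)) \<le> 2"
    if box: "a \<le> b" "b \<le> 2 ^ 1" "c \<le> d" "d \<le> 2 ^ 1" and emp: "lattice_empty 1 a b c d"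
    for a b c d
  proof -
    define w h where "w = b - (a - 1)" "h = d - (c - 1)"
    have le2: "w \<le> 2" "h \<le> 2" using box unfolding w_h_def by auto
    have "bitrev 1 1 = 1" by simp
    then have "1 < a \<or> b \<le> 1 \<or> 1 < c \<or> d \<le> 1" using lattice_emptyD[OF emp, of 1] by linarith
    then consider "w \<le> 1" | "h \<le> 1" using box unfolding w_h_def by fastforce
    then have "w * h \<le> 2"
    proof cases
      case 1
      then show ?thesis using mult_mono[of w 1 h 2] le2 by simp
    next
      case 2
      then show ?thesis using mult_mono[of w 2 h 1] le2 by simp
    qed
    then show ?thesis unfolding w_h_def .
  qed
  then have "disp (hammersley2 1) \<le> real 2 / (2 ^ 1) ^ 2"
    by (rule disp_hammersley2_le)
  then show "disp (hammersley2 1) \<le> 1 / 2" by simp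
  have "lattice_empty 1 (Suc 0) 2 (Suc 0) 1" unfolding lattice_empty_def by simp
  then have "real ((2 - 0) * (1 - 0)) / (2 ^ 1) ^ 2 \<le> disp (hammersley2 1)"
    by (intro disp_hammersley2_ge) auto
  then show "1 / 2 \<le> disp (hammersley2 1)" by simp
qed

theorem theorem4p1:
  shows "(\<forall>m::nat. m \<ge> 4 \<longrightarrow> disp (hammersley2 m) = 3 / 2 ^ m * (1 - 3 / 2 ^ m))
    \<and> disp (hammersley2 1) = 1 / 2
    \<and> disp (hammersley2 2) = 3 / 8
    \<and> disp (hammersley2 3) = 1 / 4"
  using disp_hammersley2_large disp_hammersley2_one disp_hammersley2_two disp_hammersley2_three
  by blast

end
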